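(* Let $\tau$ be a regular cardinal (regarded as the corresponding initial ordinal with its usual order) such that $\tau\leq_T\omega^\omega$. Then there exists a topological group $G$ which admits a local $\omega^\omega$-base and whose character is equal to $\tau$.
   Context: The set $\omega^\omega$ of all functions $\omega\to\omega$ carries the pointwise partial order ($\alpha\le\beta$ iff $\alpha(n)\le\beta(n)$ for all $n$). For partially ordered sets $E,D$, write $D\leq_T E$ ($D$ is Tukey reducible to, or Tukey-dominated by, $E$) if there is a map $f\colon E\to D$ sending every cofinal subset of $E$ to a cofinal subset of $D$; equivalently, there is a map $D\to E$ sending unbounded subsets of $D$ to unbounded subsets of $E$. A topological group $G$ admits a local $\omega^\omega$-base if there is a family $\{U_\alpha:\alpha\in\omega^\omega\}$ of neighbourhoods of the identity such that $\alpha\le\beta$ implies $U_\beta\subseteq U_\alpha$ and every neighbourhood of the identity contains some $U_\alpha$. The character of a topological group is the smallest cardinality of a base of neighbourhoods of the identity. *)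

theory Defs
  imports "HOL-Analysis.Abstract_Topology" "HOL-Analysis.Product_Topology" "HOL-Algebra.Group"
begin

unbundle cardinal_syntax

(* Posets are represented, as in the library theory of cardinals, by their reflexive
   order relation; the carrier is Field.  Cofinality is taken with respect to the
   reflexive order: the library constant "cofinal" asks for a different element above
   each element, so it is not the right notion for posets with maximal elements. *)

definition cofinal_subset :: "'a rel \<Rightarrow> 'a set \<Rightarrow> bool" where
  "cofinal_subset D C \<longleftrightarrow> C \<subseteq> Field D \<and> (\<forall>x\<in>Field D. \<exists>y\<in>C. (x, y) \<in> D)"

definition tukey_le :: "'a rel \<Rightarrow> 'b rel \<Rightarrow> bool" (infix "\<le>\<^sub>T" 50) where
  "D \<le>\<^sub>T E \<longleftrightarrow>
     (\<exists>f \<in> Field E \<rightarrow> Field D. \<forall>C. cofinal_subset E C \<longrightarrow> cofinal_subset D (f ` C))"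

definition omega_omega :: "(nat \<Rightarrow> nat) rel" where
  "omega_omega = {(\<alpha>, \<beta>). \<forall>n. \<alpha> n \<le> \<beta> n}"

(* The library's topological groups are type classes; here the group is a structure,
   so that one can assert the existence of one.  No separation axiom is imposed. *)

definition topological_group :: "('g, 'm) monoid_scheme \<Rightarrow> 'g topology \<Rightarrow> bool" where
  "topological_group G T \<longleftrightarrow>
     group G \<and> topspace T = carrier G \<and>
     continuous_map (prod_topology T T) T (\<lambda>(x, y). x \<otimes>\<^bsub>G\<^esub> y) \<and>
     continuous_map T T (\<lambda>x. inv\<^bsub>G\<^esub> x)"

(* Neighbourhoods need not be open. *)

definition nhood :: "'g topology \<Rightarrow> 'g \<Rightarrow> 'g set \<Rightarrow> bool" where
  "nhood T x N \<longleftrightarrow> N \<subseteq> topspace T \<and> (\<exists>V. openin T V \<and> x \<in> V \<and> V \<subseteq> N)"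

definition nhood_base :: "'g topology \<Rightarrow> 'g \<Rightarrow> 'g set set \<Rightarrow> bool" where
  "nhood_base T x B \<longleftrightarrow>
     (\<forall>N\<in>B. nhood T x N) \<and> (\<forall>N. nhood T x N \<longrightarrow> (\<exists>M\<in>B. M \<subseteq> N))"

definition local_omega_omega_base :: "('g, 'm) monoid_scheme \<Rightarrow> 'g topology \<Rightarrow> bool" where
  "local_omega_omega_base G T \<longleftrightarrow>
     (\<exists>U :: (nat \<Rightarrow> nat) \<Rightarrow> 'g set.
        (\<forall>\<alpha>. nhood T \<one>\<^bsub>G\<^esub> (U \<alpha>)) \<and>
        (\<forall>\<alpha> \<beta>. (\<alpha>, \<beta>) \<in> omega_omega \<longrightarrow> U \<beta> \<subseteq> U \<alpha>) \<and>
        (\<forall>N. nhood T \<one>\<^bsub>G\<^esub> N \<longrightarrow> (\<exists>\<alpha>. U \<alpha> \<subseteq> N)))"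

(* "The character of G is the cardinal k", as a predicate because a cardinal is only
   determined up to order isomorphism and may live on any type. *)

definition has_character :: "('g, 'm) monoid_scheme \<Rightarrow> 'g topology \<Rightarrow> 'k rel \<Rightarrow> bool" where
  "has_character G T k \<longleftrightarrow>
     (\<exists>B. nhood_base T \<one>\<^bsub>G\<^esub> B \<and> |B| =o k) \<and>
     (\<forall>B. nhood_base T \<one>\<^bsub>G\<^esub> B \<longrightarrow> (k \<le>o |B| ))"

end

theory Submission
  imports Defs
begin

text \<open>
  Let \<open>G\<close> be the Boolean group of all sets under symmetric difference, where a basic neighbourhood of
  the identity consists of the sets missing an initial segment \<open>under r x\<close>. These basic subgroups are
  indexed antitonically and faithfully by the order \<open>r\<close>, so \<open>r\<close> embeds cofinally in the reversed
  neighbourhood filter. Hence, by regularity, the character is \<open>r\<close>. If \<open>f\<close> witnesses a Tukey reduction to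
  \<open>\<omega>\<^sup>\<omega>\<close>, the points lying below \<open>f \<beta>\<close> for all \<open>\<beta> \<ge> \<alpha>\<close> form sets that grow with \<open>\<alpha>\<close>, are bounded by
  \<open>f \<alpha>\<close>, and exhaust \<open>r\<close>; the sets missing them are the required base.
\<close>

definition symdiff_group :: "'a set monoid" where
  "symdiff_group = \<lparr>carrier = UNIV, mult = sym_diff, one = {}\<rparr>"

lemma symdiff_group_simps [simp]:
  "carrier symdiff_group = UNIV"
  "A \<otimes>\<^bsub>symdiff_group\<^esub> B = sym_diff A B"
  "\<one>\<^bsub>symdiff_group\<^esub> = {}"
  by (simp_all add: symdiff_group_def)

lemma group_symdiff_group: "group symdiff_group"
  by (rule groupI) auto

lemma inv_symdiff_group [simp]: "inv\<^bsub>symdiff_group\<^esub> A = A"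
  by (rule group.inv_equality[OF group_symdiff_group]) auto

text \<open>The condition on \<open>B\<close> defines the coset of \<open>A\<close> modulo the
  subgroup of sets disjoint from \<open>under r x\<close>, so this is the group topology generated
  by these subgroups. Points outside \<open>Field r\<close> lie in no segment, so the topology need
  not be Hausdorff.\<close>

definition segment_topology :: "'a rel \<Rightarrow> 'a set topology" where
  "segment_topology r = topology (\<lambda>V. \<forall>A\<in>V. \<exists>x\<in>Field r. \<forall>B.
     B \<inter> under r x = A \<inter> under r x \<longrightarrow> B \<in> V)"

text \<open>Totality makes the basic subgroups a chain; nonemptiness of \<open>Field r\<close> makes
  the whole space open.\<close>

locale nonempty_linear_order =
  fixes r :: "'a rel"
  assumes lin: "Linear_order r" and nonempty: "Field r \<noteq> {}"
begin

lemma under_mono: "(x, y) \<in> r \<Longrightarrow> under r x \<subseteq> under r y"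
  using lin unfolding order_on_defs under_def by (blast dest: transD)

lemma order_total: "x \<in> Field r \<Longrightarrow> y \<in> Field r \<Longrightarrow> (x, y) \<in> r \<or> (y, x) \<in> r"
  using lin unfolding order_on_defs total_on_def refl_on_def by metis

lemma mem_under: "x \<in> Field r \<Longrightarrow> x \<in> under r x"
  using lin unfolding order_on_defs under_def by (blast dest: refl_onD)

lemma common_upper_bound:
  assumes "x \<in> Field r" "y \<in> Field r"
  obtains z where "z \<in> Field r" "under r x \<subseteq> under r z" "under r y \<subseteq> under r z"
proof (cases "(x, y) \<in> r")
  case True
  from that[OF assms(2) under_mono[OF True] order_refl] show ?thesis .
next
  case False
  then have "(y, x) \<in> r" using order_total assms by blast
  from that[OF assms(1) order_refl under_mono[OF this]] show ?thesis .
qed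

text \<open>Agreement on a segment implies agreement on every smaller one, so for an intersection
  the larger of the two segments works.\<close>

lemma istopology_segment:
  "istopology (\<lambda>V. \<forall>A\<in>V. \<exists>x\<in>Field r. \<forall>B. B \<inter> under r x = A \<inter> under r x \<longrightarrow> B \<in> V)"
    (is "istopology ?P")
  unfolding istopology_def
proof (intro conjI allI impI)
  fix S T assume S: "?P S" and T: "?P T"
  show "?P (S \<inter> T)"
  proof
    fix A assume "A \<in> S \<inter> T"
    then have "A \<in> S" "A \<in> T" by simp_all
    from bspec[OF S this(1)] obtain x
      where x: "x \<in> Field r" "\<forall>B. B \<inter> under r x = A \<inter> under r x \<longrightarrow> B \<in> S" ..
    from bspec[OF T \<open>A \<in> T\<close>] obtain y
      where y: "y \<in> Field r" "\<forall>B. B \<inter> under r y = A \<inter> under r y \<longrightarrow> B \<in> T" ..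
    obtain z where z: "z \<in> Field r" "under r x \<subseteq> under r z" "under r y \<subseteq> under r z"
      using common_upper_bound[OF x(1) y(1)] .
    have "\<forall>B. B \<inter> under r z = A \<inter> under r z \<longrightarrow> B \<in> S \<inter> T"
    proof (intro allI impI)
      fix B assume "B \<inter> under r z = A \<inter> under r z"
      then have "B \<inter> under r x = A \<inter> under r x" "B \<inter> under r y = A \<inter> under r y"
        using z(2,3) by blast+
      with x(2) y(2) show "B \<in> S \<inter> T" by simp
    qed
    with z(1) show "\<exists>x\<in>Field r. \<forall>B. B \<inter> under r x = A \<inter> under r x \<longrightarrow> B \<in> S \<inter> T" ..
  qed
next
  fix K assume K: "\<forall>V\<in>K. ?P V"
  show "?P (\<Union>K)"
  proof
    fix A assume "A \<in> \<Union>K"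
    then obtain V where "V \<in> K" "A \<in> V" by blast
    from bspec[OF bspec[OF K this(1)] this(2)] obtain x
      where "x \<in> Field r" "\<forall>B. B \<inter> under r x = A \<inter> under r x \<longrightarrow> B \<in> V" ..
    with \<open>V \<in> K\<close> show "\<exists>x\<in>Field r. \<forall>B. B \<inter> under r x = A \<inter> under r x \<longrightarrow> B \<in> \<Union>K"
      by blast
  qed
qed

lemma openin_segment:
  "openin (segment_topology r) V \<longleftrightarrow>
     (\<forall>A\<in>V. \<exists>x\<in>Field r. \<forall>B. B \<inter> under r x = A \<inter> under r x \<longrightarrow> B \<in> V)"
  unfolding segment_topology_def by (simp only: topology_inverse'[OF istopology_segment])

lemma openin_segmentE:
  assumes "openin (segment_topology r) V" "A \<in> V"
  obtains x where "x \<in> Field r" "{B. B \<inter> under r x = A \<inter> under r x} \<subseteq> V"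
proof -
  from bspec[OF assms(1)[unfolded openin_segment] assms(2)] obtain x
    where x: "x \<in> Field r" "\<forall>B. B \<inter> under r x = A \<inter> under r x \<longrightarrow> B \<in> V" ..
  show ?thesis by (rule that[OF x(1)]) (use x(2) in \<open>simp add: subset_eq\<close>)
qed

text \<open>Agreement on \<open>under r x\<close> is an equivalence relation, so the same
  \<open>x\<close> serves at every point of the class.\<close>

lemma openin_coset:
  "x \<in> Field r \<Longrightarrow> openin (segment_topology r) {B. B \<inter> under r x = A \<inter> under r x}"
  unfolding openin_segment by auto

lemma topspace_segment [simp]: "topspace (segment_topology r) = UNIV"
proof -
  have "openin (segment_topology r) UNIV" using nonempty by (auto simp: openin_segment)
  then show ?thesis by (metis openin_subset top.extremum_uniqueI)
qed

lemma nhood_segment: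
  "nhood (segment_topology r) A N \<longleftrightarrow>
     (\<exists>x\<in>Field r. {B. B \<inter> under r x = A \<inter> under r x} \<subseteq> N)"
proof
  assume "nhood (segment_topology r) A N"
  then obtain V where V: "openin (segment_topology r) V" "A \<in> V" "V \<subseteq> N"
    unfolding nhood_def by metis
  from V(1,2) obtain x where "x \<in> Field r" "{B. B \<inter> under r x = A \<inter> under r x} \<subseteq> V"
    by (rule openin_segmentE)
  with V(3) show "\<exists>x\<in>Field r. {B. B \<inter> under r x = A \<inter> under r x} \<subseteq> N"
    by (meson order_trans)
next
  assume "\<exists>x\<in>Field r. {B. B \<inter> under r x = A \<inter> under r x} \<subseteq> N"
  then obtain x where x: "x \<in> Field r" "{B. B \<inter> under r x = A \<inter> under r x} \<subseteq> N" ..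
  then show "nhood (segment_topology r) A N"
    unfolding nhood_def using openin_coset[OF x(1), of A]
    by (intro conjI exI[of _ "{B. B \<inter> under r x = A \<inter> under r x}"]) simp_all
qed

lemma nhood_empty_segment:
  "nhood (segment_topology r) {} N \<longleftrightarrow> (\<exists>x\<in>Field r. {B. B \<inter> under r x = {}} \<subseteq> N)"
  by (simp add: nhood_segment)

text \<open>Symmetric difference is computed pointwise: its trace on a segment depends only on the
  traces of the two arguments there. Inversion is the identity map.\<close>

lemma topological_group_segment: "topological_group symdiff_group (segment_topology r)"
proof -
  let ?T = "segment_topology r"
  have "openin (prod_topology ?T ?T) {p. sym_diff (fst p) (snd p) \<in> V}" if V: "openin ?T V" for V
    unfolding openin_prod_topology_alt
  proof (intro allI impI)
    fix A B assume "(A, B) \<in> {p. sym_diff (fst p) (snd p) \<in> V}"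
    then have "sym_diff A B \<in> V" by simp
    with V obtain x where x: "x \<in> Field r"
      and sub: "{C. C \<inter> under r x = sym_diff A B \<inter> under r x} \<subseteq> V"
      by (rule openin_segmentE)
    let ?U = "\<lambda>A. {C. C \<inter> under r x = A \<inter> under r x}"
    have "?U A \<times> ?U B \<subseteq> {p. sym_diff (fst p) (snd p) \<in> V}"
    proof
      fix p assume "p \<in> ?U A \<times> ?U B"
      then have "fst p \<inter> under r x = A \<inter> under r x" "snd p \<inter> under r x = B \<inter> under r x"
        by (simp_all add: mem_Times_iff)
      then have "sym_diff (fst p) (snd p) \<inter> under r x = sym_diff A B \<inter> under r x"
        by blast
      with sub show "p \<in> {p. sym_diff (fst p) (snd p) \<in> V}" by (simp add: subset_eq)
    qed
    then show "\<exists>U W. openin ?T U \<and> openin ?T W \<and> A \<in> U \<and> B \<in> W \<and>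
        U \<times> W \<subseteq> {p. sym_diff (fst p) (snd p) \<in> V}"
      using openin_coset[OF x] by (intro exI[of _ "?U A"] exI[of _ "?U B"]) simp
  qed
  then have "continuous_map (prod_topology ?T ?T) ?T (\<lambda>(A, B). sym_diff A B)"
    by (simp add: continuous_map_def case_prod_unfold)
  then show ?thesis
    by (simp add: topological_group_def group_symdiff_group)
qed

text \<open>This equivalence carries questions about neighbourhoods back to the order: it gives both
  the distinctness of the basic subgroups and the lower bound on the character.\<close>

lemma disjoint_under_subset_iff:
  assumes "x \<in> Field r" "y \<in> Field r"
  shows "{A. A \<inter> under r y = {}} \<subseteq> {A. A \<inter> under r x = {}} \<longleftrightarrow> (x, y) \<in> r"
proof
  assume sub: "{A. A \<inter> under r y = {}} \<subseteq> {A. A \<inter> under r x = {}}"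
  \<comment> \<open>The singleton of \<open>x\<close> separates the two subgroups unless
    \<open>x\<close> lies below \<open>y\<close>.\<close>
  have "{x} \<inter> under r x \<noteq> {}" using mem_under[OF assms(1)] by blast
  with sub have "{x} \<inter> under r y \<noteq> {}" by blast
  then show "(x, y) \<in> r" by (simp add: under_def)
next
  assume "(x, y) \<in> r"
  then show "{A. A \<inter> under r y = {}} \<subseteq> {A. A \<inter> under r x = {}}"
    using under_mono by blast
qed

lemma local_omega_omega_base_segment:
  assumes "r \<le>\<^sub>T omega_omega"
  shows "local_omega_omega_base symdiff_group (segment_topology r)"
proof -
  let ?T = "segment_topology r"
  have Field_oo: "Field omega_omega = UNIV"
    by (auto simp: omega_omega_def Field_def)
  have refl_oo: "(\<alpha>, \<alpha>) \<in> omega_omega" for \<alpha>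
    by (simp add: omega_omega_def)
  have trans_oo: "(\<alpha>, \<gamma>) \<in> omega_omega"
    if "(\<alpha>, \<beta>) \<in> omega_omega" "(\<beta>, \<gamma>) \<in> omega_omega" for \<alpha> \<beta> \<gamma>
    using that order_trans unfolding omega_omega_def by blast
  obtain f where f: "\<And>\<alpha>. f \<alpha> \<in> Field r"
    and cof: "\<And>C. cofinal_subset omega_omega C \<Longrightarrow> cofinal_subset r (f ` C)"
    using assms unfolding tukey_le_def Field_oo by blast
  \<comment> \<open>Since \<open>f\<close> need not be monotone, the bound is required at every
    \<open>\<beta>\<close> above \<open>\<alpha>\<close>; this makes \<open>S\<close>
    increasing.\<close>
  define S where "S \<alpha> = {x. \<forall>\<beta>. (\<alpha>, \<beta>) \<in> omega_omega \<longrightarrow> (x, f \<beta>) \<in> r}" for \<alpha>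
  define U where "U \<alpha> = {A. A \<inter> S \<alpha> = {}}" for \<alpha>
  have exhaust: "\<exists>\<alpha>. x \<in> S \<alpha>" if x: "x \<in> Field r" for x
  proof (rule ccontr)
    assume "\<nexists>\<alpha>. x \<in> S \<alpha>"
    \<comment> \<open>Every \<open>\<alpha>\<close> now has some \<open>\<beta>\<close> above it
      with \<open>f \<beta>\<close> not above \<open>x\<close>. The image of these
      \<open>\<beta>\<close> would be cofinal, yet nothing in it is above \<open>x\<close>.\<close>
    then have "cofinal_subset omega_omega {\<beta>. (x, f \<beta>) \<notin> r}"
      unfolding cofinal_subset_def S_def Field_oo by blast
    from cof[OF this] x show False
      unfolding cofinal_subset_def by blast
  qed
  have "nhood ?T {} (U \<alpha>)" for \<alpha>
  proof -
    have "S \<alpha> \<subseteq> under r (f \<alpha>)"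
      using refl_oo unfolding S_def under_def by blast
    then show ?thesis
      unfolding nhood_empty_segment U_def using f[of \<alpha>] by blast
  qed
  moreover have "U \<beta> \<subseteq> U \<alpha>" if "(\<alpha>, \<beta>) \<in> omega_omega" for \<alpha> \<beta>
  proof -
    have "S \<alpha> \<subseteq> S \<beta>" using trans_oo that unfolding S_def by blast
    then show ?thesis unfolding U_def by blast
  qed
  moreover have "\<exists>\<alpha>. U \<alpha> \<subseteq> N" if "nhood ?T {} N" for N
  proof -
    from that obtain x where x: "x \<in> Field r" "{B. B \<inter> under r x = {}} \<subseteq> N"
      unfolding nhood_empty_segment by blast
    obtain \<alpha> where "x \<in> S \<alpha>" using exhaust[OF x(1)] by blast
    \<comment> \<open>By transitivity \<open>S \<alpha>\<close> is closed downwards.\<close>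
    then have "under r x \<subseteq> S \<alpha>"
      using under_mono unfolding S_def under_def by blast
    with x(2) show ?thesis unfolding U_def by blast
  qed
  ultimately show ?thesis
    unfolding local_omega_omega_base_def by auto
qed

end

text \<open>The basic subgroups form a base of size \<open>r\<close>. Conversely, choosing a basic
  subgroup inside each member of a base gives a set of indices; if there were fewer than
  \<open>r\<close> of them, regularity would keep them from being cofinal, and some basic subgroup
  would contain no member of the base.\<close>

lemma has_character_segment:
  assumes inf: "Cinfinite r" and reg: "regularCard r"
  shows "has_character symdiff_group (segment_topology r) r"
proof -
  have card: "Card_order r" and infin: "infinite (Field r)"
    using inf by (simp_all add: cinfinite_def)
  have lin: "Linear_order r"
    using card by (simp add: card_order_on_def well_order_on_def)
  interpret nonempty_linear_order r
    using lin infin by unfold_locales auto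
  let ?T = "segment_topology r"
  let ?U = "\<lambda>x. {A. A \<inter> under r x = {}}"
  have "nhood_base ?T {} (?U ` Field r)"
    unfolding nhood_base_def nhood_empty_segment by simp (meson order_refl)
  moreover have "|?U ` Field r| =o r"
  proof -
    have "inj_on ?U (Field r)"
    proof (rule inj_onI)
      fix x y assume "x \<in> Field r" "y \<in> Field r" "?U x = ?U y"
      then have "(x, y) \<in> r" "(y, x) \<in> r"
        using disjoint_under_subset_iff by (metis order_refl)+
      then show "x = y" using lin unfolding order_on_defs antisym_def by blast
    qed
    then have "|?U ` Field r| =o |Field r|"
      by (meson card_of_ordIso inj_on_imp_bij_betw ordIso_symmetric)
    then show ?thesis using card_of_Field_ordIso[OF card] ordIso_transitive by blast
  qed
  moreover have "r \<le>o |B|" if B: "nhood_base ?T {} B" for B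
  proof (rule ccontr)
    assume "\<not> r \<le>o |B|"
    then have less: "|B| <o r"
      using card card_order_on_well_order_on card_of_Well_order not_ordLeq_iff_ordLess by blast
    have "\<forall>N\<in>B. \<exists>x\<in>Field r. ?U x \<subseteq> N"
      using B by (simp add: nhood_base_def nhood_empty_segment)
    then obtain g where g: "\<And>N. N \<in> B \<Longrightarrow> g N \<in> Field r" "\<And>N. N \<in> B \<Longrightarrow> ?U (g N) \<subseteq> N"
      by metis
    have "|g ` B| <o r"
      using card_of_image less ordLeq_ordLess_trans by blast
    then have "\<not> cofinal (g ` B) r"
      using reg g(1) unfolding regularCard_def by (metis image_subsetI not_ordLess_ordIso)
    \<comment> \<open>The constant \<open>cofinal\<close> asks for an element strictly above, so its
      failure at \<open>x\<close> still allows \<open>g N = x\<close>.\<close>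
    then obtain x where x: "x \<in> Field r" and bound: "\<And>N. N \<in> B \<Longrightarrow> g N = x \<or> (x, g N) \<notin> r"
      unfolding cofinal_def by (metis imageI)
    \<comment> \<open>Passing to a strictly larger \<open>y\<close>, which exists because an
      infinite cardinal has no last element, rules out the case \<open>g N = x\<close>.\<close>
    obtain y where y: "y \<in> Field r" "x \<noteq> y" "(x, y) \<in> r"
      using infinite_Card_order_limit[OF card infin x] by (auto simp: Field_def)
    have "nhood ?T {} (?U y)" using y(1) by (metis nhood_empty_segment order_refl)
    with B obtain N where N: "N \<in> B" "N \<subseteq> ?U y" unfolding nhood_base_def by metis
    have "?U (g N) \<subseteq> ?U y" using order_trans[OF g(2)[OF N(1)] N(2)] .
    then have "(y, g N) \<in> r" using disjoint_under_subset_iff y(1) g(1) N(1) by simp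
    moreover from this y(3) have "(x, g N) \<in> r"
      using lin unfolding order_on_defs by (blast dest: transD)
    ultimately show False
      using bound[OF N(1)] y(2,3) lin unfolding order_on_defs antisym_def by blast
  qed
  ultimately show ?thesis unfolding has_character_def by auto
qed

theorem corollary2p9:
  fixes \<tau> :: "'a rel"
  assumes "Cinfinite \<tau>" and "regularCard \<tau>"
    and "\<tau> \<le>\<^sub>T omega_omega"
  shows "\<exists>(G :: 'a set monoid) (T :: 'a set topology).
           topological_group G T \<and> local_omega_omega_base G T \<and> has_character G T \<tau>"
proof -
  interpret nonempty_linear_order \<tau>
    using assms(1) by unfold_locales
      (auto simp: cinfinite_def card_order_on_def well_order_on_def)
  show ?thesis
    using topological_group_segment local_omega_omega_base_segment[OF assms(3)]
      has_character_segment[OF assms(1,2)] by blast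
qed

end
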